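(* Let $P \subset \mathbb{R}^3$ be a homogeneous, three-dimensional convex polyhedron. If $P$ is mono-unstable, then $P$ has at least $7$ vertices.
   Context: A convex polyhedron here is a bounded convex polytope, i.e. the convex hull of finitely many points, and three-dimensional means it has nonempty interior. Homogeneous means that the mass is uniformly distributed over the solid $P$, so the center of mass is the centroid $c = \frac{1}{\mathrm{vol}(P)}\int_P x\,dx$. A vertex $v$ of $P$ is called a (nondegenerate) unstable vertex of $P$ if the plane that contains $v$ and is orthogonal to the line connecting $c$ and $v$ (the vertex orthoplane of $P$ at $v$) intersects $P$ only at $v$. The unstable equilibria of $P$ are exactly its unstable vertices. $P$ is mono-unstable if it has exactly one unstable vertex. *)

theory Defs
  imports "HOL-Analysis.Analysis"
begin

definition centroid :: "'a::euclidean_space set \<Rightarrow> 'a" where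
  "centroid P = (1 / measure lebesgue P) *\<^sub>R integral P (\<lambda>x. x)"

(* The hyperplane through v orthogonal to the line through the centroid and v.
   It degenerates to the whole space if v is the centroid; this does not occur for a
   vertex of a convex body with nonempty interior, whose centroid is an interior point. *)
definition vertex_orthoplane :: "'a::euclidean_space set \<Rightarrow> 'a \<Rightarrow> 'a set" where
  "vertex_orthoplane P v = {x. (v - centroid P) \<bullet> (x - v) = 0}"

definition vertices :: "'a::euclidean_space set \<Rightarrow> 'a set" where
  "vertices P = {v. v extreme_point_of P}"

definition unstable_vertex :: "'a::euclidean_space set \<Rightarrow> 'a \<Rightarrow> bool" where
  "unstable_vertex P v \<longleftrightarrow> v \<in> vertices P \<and> vertex_orthoplane P v \<inter> P = {v}"

definition mono_unstable :: "'a::euclidean_space set \<Rightarrow> bool" where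
  "mono_unstable P \<longleftrightarrow> (\<exists>!v. unstable_vertex P v)"

end

theory Submission
  imports Defs
begin

text \<open>
  Let $c$ be the centroid of $P$ and $u$ its only unstable vertex, and measure all vertices from $c$. A vertex
  $v$ that is not unstable has another vertex $w$ on or beyond its orthoplane, that is,
  $v \cdot v \le v \cdot w$: the vertex $v$ lies in the Thales ball with diameter $[c, w]$. Then
  $|v| < |w|$, so going from $v$ to $w$ repeatedly ends in the only vertex that has no such
  partner, which is $u$. The vertices thus form a tree with root $u$, in which each vertex lies in the
  Thales ball of its parent. Reaching far to the side of $c$ that is opposite to $u$ takes a spiral with
  many steps: a vertex at distance $k$ from the root has height $u \cdot v$ at least
  $-\cos^{k+1} (\pi / (k + 1)) \, |u|^2$, that is about $0$, $-1/8$, $-1/4$, $-0.347$, $-0.422$ times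
  $|u|^2$ for $k = 1, \dots, 5$.

  On the other hand, the centroid forces vertices to lie far on that side. The cone decomposition of $P$
  from $u$ suggests that $c$ is a convex combination of the vertices with weight $1/4$ at $u$ and
  weights at most $1/4$ elsewhere, so the three lowest vertices have heights of
  sum at most $-|u|^2$. The lemma \<open>centroid_lower_bound\<close> proves what is needed of this without
  a triangulation: the largest weight that a vertex $v$ can have in a convex combination representing a
  point $x \in P$ is at least $s$ exactly if $x$ lies in the copy $s v + (1 - s) P$, whose volume is
  $(1 - s)^3$ times that of $P$, so the mean of this largest weight over $P$ is
  $\int_0^1 (1 - s)^3 ds = 1/4$ for every vertex. In the form used, the excesses of the vertices below the
  height $-|u|^2/4$ have sum at least $|u|^2/4$.

  With at most five vertices besides $u$ this is impossible, as \<open>five_thales_points\<close> shows: vertices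
  at distance at most $3$ have no excess. Two vertices at distance $4$ have too little. The remaining
  case is a single chain of five steps; there the bounds for its two last points taken separately
  would not suffice, but these two points cannot both be extremal, and the sum of their heights is
  above $-\frac34 |u|^2$.
\<close>

section \<open>Maximal weights and the centroid\<close>

definition homothet :: "'a::real_vector \<Rightarrow> 'a set \<Rightarrow> real \<Rightarrow> 'a set" where
  "homothet v P s = (\<lambda>y. s *\<^sub>R v + (1 - s) *\<^sub>R y) ` P"

text \<open>
  If $P$ is compact and convex and $x \in P$, the set of these $s$ is an interval $[0, \Lambda]$, so its length is the largest
  weight that $v$ can have in a representation of $x$ as a convex combination of points of $P$.
  Defining $\Lambda$ as a length instead of a supremum turns its integral over $P$ into the volume
  of a subset of a product space.
\<close>

definition max_weight :: "'a::euclidean_space \<Rightarrow> 'a set \<Rightarrow> 'a \<Rightarrow> real" where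
  "max_weight v P x = measure lborel {s\<in>{0..1}. x \<in> homothet v P s}"

lemma compact_homothety_graph:
  fixes v :: "'a::euclidean_space"
  assumes "compact P"
  shows "compact {(x, s). s \<in> {0..1} \<and> x \<in> homothet v P s}"
proof -
  have "{(x, s). s \<in> {0..1} \<and> x \<in> homothet v P s}
      = (\<lambda>(y, s). (s *\<^sub>R v + (1 - s) *\<^sub>R y, s)) ` (P \<times> {0..1})"
    by (auto simp: homothet_def image_iff)
  moreover have "compact \<dots>"
    by (intro compact_continuous_image compact_Times assms compact_Icc)
       (auto simp: case_prod_unfold intro!: continuous_intros)
  ultimately show ?thesis by simp
qed

lemma compact_weights:
  fixes v :: "'a::euclidean_space"
  assumes "compact P"
  shows "compact {s\<in>{0..1}. x \<in> homothet v P s}"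
proof -
  have "closed (Pair x -` {(x, s). s \<in> {0..1} \<and> x \<in> homothet v P s})"
    by (intro closed_vimage compact_imp_closed compact_homothety_graph assms continuous_intros)
  moreover have "Pair x -` {(x, s). s \<in> {0..1} \<and> x \<in> homothet v P s} = {s\<in>{0..1}. x \<in> homothet v P s}"
    by auto
  moreover have "bounded {s\<in>{0..1::real}. x \<in> homothet v P s}"
    by (rule bounded_subset[of "{0..1}"]) auto
  ultimately show ?thesis by (simp add: compact_eq_bounded_closed)
qed

lemma emeasure_homothet:
  fixes v :: "'a::euclidean_space"
  assumes "compact P" "0 \<le> s" "s \<le> 1"
  shows "emeasure lborel (homothet v P s) = ennreal ((1 - s) ^ DIM('a)) * emeasure lborel P"
proof -
  have "compact (homothet v P s)"
    unfolding homothet_def using assms(1) by (intro compact_continuous_image continuous_intros)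
  moreover have "homothet v P s = (\<lambda>x. (1 - s) *\<^sub>R x + s *\<^sub>R v) ` P"
    by (simp add: homothet_def add.commute)
  ultimately show ?thesis
    using emeasure_lebesgue_affine[of "1 - s" "s *\<^sub>R v" P] assms
    by (simp add: borel_compact ennreal_power add.commute)
qed

text \<open>
  The integral is the volume of the compact set $\{(x, s) \mid 0 \le s \le 1, \, x \in s v + (1 - s) P\}$, since
  slicing at a fixed $x$ gives the maximal weight. By Fubini's theorem, slicing at a fixed $s$ instead gives
  $\int_0^1 (1 - s)^d \, \mathrm{vol}(P) \, ds$.
\<close>

lemma has_integral_max_weight:
  fixes v :: "'a::euclidean_space"
  assumes "compact P"
  shows "has_bochner_integral lborel (max_weight v P) (measure lborel P / (DIM('a) + 1))"
proof -
  let ?K = "{(x, s). s \<in> {0..1} \<and> x \<in> homothet v P s}"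
  have K: "?K \<in> sets (lborel \<Otimes>\<^sub>M lborel)"
    unfolding lborel_prod using compact_homothety_graph[OF assms] by (simp add: borel_compact)
  have slice_at_point: "emeasure lborel (Pair x -` ?K) = ennreal (max_weight v P x)" for x
  proof -
    have "Pair x -` ?K = {s\<in>{0..1}. x \<in> homothet v P s}" by auto
    moreover have "emeasure lborel {s\<in>{0..1}. x \<in> homothet v P s} < \<infinity>"
      by (intro emeasure_compact_finite compact_weights assms)
    ultimately show ?thesis
      by (simp add: max_weight_def emeasure_eq_ennreal_measure)
  qed
  have vol: "emeasure lborel P = ennreal (measure lborel P)"
    using emeasure_compact_finite[OF assms] by (simp add: emeasure_eq_ennreal_measure)
  have slice_at_weight: "emeasure lborel ((\<lambda>x. (x, s)) -` ?K)
      = ennreal ((1 - s) ^ DIM('a)) * indicator {0..1} s * emeasure lborel P" for s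
  proof (cases "s \<in> {0..1}")
    case True
    then have "(\<lambda>x. (x, s)) -` ?K = homothet v P s" by auto
    then show ?thesis using True emeasure_homothet[OF assms, of s v] by simp
  next
    case False
    then have "(\<lambda>x. (x, s)) -` ?K = {}" by auto
    then show ?thesis using False by (simp only: ) simp
  qed
  have "(\<integral>\<^sup>+x. ennreal (max_weight v P x) \<partial>lborel) = emeasure (lborel \<Otimes>\<^sub>M lborel) ?K"
    using lborel.emeasure_pair_measure_alt[OF K] slice_at_point by simp
  also have "\<dots> = (\<integral>\<^sup>+s. ennreal ((1 - s) ^ DIM('a)) * indicator {0..1} s * emeasure lborel P \<partial>lborel)"
    using lborel_pair.emeasure_pair_measure_alt2[OF K] slice_at_weight by simp
  also have "\<dots> = (\<integral>\<^sup>+s. ennreal ((1 - s) ^ DIM('a)) * indicator {0..1} s \<partial>lborel) * emeasure lborel P"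
    by (rule nn_integral_multc) auto
  also have "(\<integral>\<^sup>+s. ennreal ((1 - s) ^ DIM('a)) * indicator {0..1::real} s \<partial>lborel)
      = ennreal (- ((1 - 1) ^ Suc DIM('a)) / Suc DIM('a) - - ((1 - 0) ^ Suc DIM('a)) / Suc DIM('a))"
  proof (rule nn_integral_FTC_Icc)
    show "((\<lambda>s. - ((1 - s) ^ Suc DIM('a)) / Suc DIM('a)) has_real_derivative (1 - s) ^ DIM('a)) (at s)"
      for s :: real
      by (rule derivative_eq_intros refl)+ (simp_all del: of_nat_Suc power_Suc)
  qed auto
  also have "\<dots> * emeasure lborel P = ennreal (measure lborel P / (DIM('a) + 1))"
    by (simp add: vol flip: ennreal_mult)
  finally have nn: "(\<integral>\<^sup>+x. ennreal (max_weight v P x) \<partial>lborel) = ennreal (measure lborel P / (DIM('a) + 1))" .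
  have "(\<lambda>x. emeasure lborel (Pair x -` ?K)) \<in> borel_measurable lborel"
    by (intro lborel.measurable_emeasure_Pair K)
  then have "(\<lambda>x. enn2real (emeasure lborel (Pair x -` ?K))) \<in> borel_measurable lborel"
    by measurable
  then have "max_weight v P \<in> borel_measurable lborel"
    unfolding slice_at_point by (simp add: max_weight_def[abs_def])
  then show ?thesis
    using nn by (intro has_bochner_integral_nn_integral) (auto simp: max_weight_def)
qed

text \<open>
  If $v$ has weight $\lambda$ in a convex combination, then any part $s < \lambda$ of this weight can
  be split off, which exhibits the point in the copy of the polytope shrunk towards $v$ by the factor
  $1 - s$. Strictness of $s < \lambda$ keeps this factor positive and does not change the length.
\<close>

lemma weight_le_max_weight:
  fixes v :: "'a::euclidean_space"
  assumes V: "finite V" "v \<in> V"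
    and l: "\<And>w. w \<in> V \<Longrightarrow> 0 \<le> l w" "sum l V = 1" and x: "x = (\<Sum>w\<in>V. l w *\<^sub>R w)"
  shows "l v \<le> max_weight v (convex hull V) x"
proof -
  have lv: "l v \<le> 1" using member_le_sum[of v V l] V l by auto
  have mem: "x \<in> homothet v (convex hull V) s" if s: "0 \<le> s" "s < l v" for s
  proof -
    define k where "k w = (l w - (if w = v then s else 0)) / (1 - s)" for w
    have s1: "s < 1" using s lv by simp
    have "(\<Sum>w\<in>V. k w) = (sum l V - (\<Sum>w\<in>V. if w = v then s else 0)) / (1 - s)"
      unfolding k_def by (simp only: sum_divide_distrib[symmetric] sum_subtractf)
    then have "sum k V = 1" using V l s1 by simp
    moreover have "0 \<le> k w" if "w \<in> V" for w
      using l(1)[OF that] s s1 by (auto simp: k_def)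
    ultimately have "(\<Sum>w\<in>V. k w *\<^sub>R w) \<in> convex hull V"
      using V by (auto simp: convex_hull_finite)
    moreover have "s *\<^sub>R v + (1 - s) *\<^sub>R (\<Sum>w\<in>V. k w *\<^sub>R w) = x"
    proof -
      have "(1 - s) *\<^sub>R (\<Sum>w\<in>V. k w *\<^sub>R w) = (\<Sum>w\<in>V. l w *\<^sub>R w - (if w = v then s *\<^sub>R v else 0))"
        unfolding scaleR_sum_right using s1
        by (intro sum.cong) (auto simp: k_def scaleR_left_diff_distrib)
      also have "\<dots> = x - s *\<^sub>R v" using V by (simp add: sum_subtractf x)
      finally show ?thesis by simp
    qed
    ultimately show ?thesis
      unfolding homothet_def by (intro image_eqI[where x = "\<Sum>w\<in>V. k w *\<^sub>R w"]) simp_all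
  qed
  have "l v = measure lborel {0..<l v}" using l V by simp
  also have "\<dots> \<le> max_weight v (convex hull V) x"
    unfolding max_weight_def
  proof (rule measure_mono_fmeasurable)
    have "compact {s\<in>{0..1}. x \<in> homothet v (convex hull V) s}"
      by (intro compact_weights finite_imp_compact_convex_hull V)
    then show "{s\<in>{0..1}. x \<in> homothet v (convex hull V) s} \<in> fmeasurable lborel"
      using emeasure_compact_finite by (auto simp: fmeasurable_def borel_compact)
  qed (use mem lv in auto)
  finally show ?thesis .
qed

text \<open>
  Among the representations of $x$ as a convex combination of $V$, take one that gives $u$ the
  largest weight. In $a \cdot x - m = \sum_w \lambda_w (a \cdot w - m)$ the term of $u$ is then
  known from below, every other weight is at most its maximum, and the terms with
  $a \cdot w \ge m$ may be dropped. The bound is expressed by maximal weights only, so no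
  measurable choice of the representation is involved when it is integrated.
\<close>

lemma functional_lower_bound:
  fixes u :: "'a::euclidean_space" and m :: real
  assumes V: "finite V" "u \<in> V" and m: "m \<le> a \<bullet> u" and x: "x \<in> convex hull V"
  shows "m + max_weight u (convex hull V) x * (a \<bullet> u - m)
     - (\<Sum>v\<in>V - {u}. max_weight v (convex hull V) x * max 0 (m - a \<bullet> v)) \<le> a \<bullet> x"
proof -
  let ?P = "convex hull V" and ?S = "{s\<in>{0..1}. x \<in> homothet u (convex hull V) s}"
  have "0 \<in> ?S" using x by (auto simp: homothet_def)
  moreover have "compact ?S" by (intro compact_weights finite_imp_compact_convex_hull V)
  ultimately obtain t where t: "t \<in> ?S" "\<And>s. s \<in> ?S \<Longrightarrow> s \<le> t"
    using compact_attains_sup[of ?S] by blast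
  have "max_weight u ?P x \<le> measure lborel {0..t}"
    unfolding max_weight_def
    by (rule measure_mono_fmeasurable)
       (use t \<open>compact ?S\<close> in \<open>auto simp: borel_compact fmeasurable_def\<close>)
  then have wt: "max_weight u ?P x \<le> t" using t by simp
  obtain y where y: "y \<in> ?P" "x = t *\<^sub>R u + (1 - t) *\<^sub>R y"
    using t by (auto simp: homothet_def)
  obtain k where k: "\<And>w. w \<in> V \<Longrightarrow> 0 \<le> k w" "sum k V = 1" "y = (\<Sum>w\<in>V. k w *\<^sub>R w)"
    using y(1) V by (auto simp: convex_hull_finite)
  \<comment> \<open>the largest weight $t$ of $u$ is split off first; what remains is spread as in $y$\<close>
  define l where "l w = (1 - t) * k w + (if w = u then t else 0)" for w
  have l0: "0 \<le> l w" if "w \<in> V" for w using k(1)[OF that] t by (auto simp: l_def)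
  have l1: "sum l V = 1"
    using V k by (simp add: l_def sum.distrib flip: sum_distrib_left)
  have lx: "x = (\<Sum>w\<in>V. l w *\<^sub>R w)"
  proof -
    have "(\<Sum>w\<in>V. l w *\<^sub>R w) = (\<Sum>w\<in>V. (1 - t) *\<^sub>R k w *\<^sub>R w + (if w = u then t *\<^sub>R u else 0))"
      by (intro sum.cong) (auto simp: l_def scaleR_left_distrib)
    also have "\<dots> = x"
      using V by (simp add: sum.distrib y k scaleR_sum_right)
    finally show ?thesis by simp
  qed
  have "a \<bullet> x - m = (\<Sum>w\<in>V. l w * (a \<bullet> w - m))"
    using l1 by (simp add: lx inner_sum_right right_diff_distrib sum_subtractf flip: sum_distrib_right)
  also have "\<dots> = l u * (a \<bullet> u - m) + (\<Sum>w\<in>V - {u}. l w * (a \<bullet> w - m))"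
    using V by (simp add: sum.remove)
  finally have eq: "a \<bullet> x - m = \<dots>" .
  have "max_weight u ?P x \<le> l u"
    using wt t k(1)[OF V(2)] by (simp add: l_def add_increasing)
  then have "max_weight u ?P x * (a \<bullet> u - m) \<le> l u * (a \<bullet> u - m)"
    using m by (intro mult_right_mono) auto
  moreover have "(\<Sum>w\<in>V - {u}. - (max_weight w ?P x * max 0 (m - a \<bullet> w))) \<le> (\<Sum>w\<in>V - {u}. l w * (a \<bullet> w - m))"
  proof (rule sum_mono)
    fix w assume w: "w \<in> V - {u}"
    have "l w * (m - a \<bullet> w) \<le> l w * max 0 (m - a \<bullet> w)"
      using l0[of w] w by (intro mult_left_mono) auto
    also have "\<dots> \<le> max_weight w ?P x * max 0 (m - a \<bullet> w)"
      using weight_le_max_weight[OF V(1) _ l0 l1 lx, of w] w by (intro mult_right_mono) auto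
    finally show "- (max_weight w ?P x * max 0 (m - a \<bullet> w)) \<le> l w * (a \<bullet> w - m)"
      by (simp add: algebra_simps)
  qed
  ultimately show ?thesis using eq by (simp add: sum_negf)
qed

lemma max_weight_outside:
  fixes v :: "'a::euclidean_space"
  assumes "convex P" "v \<in> P" "x \<notin> P"
  shows "max_weight v P x = 0"
proof -
  have "homothet v P s \<subseteq> P" if "s \<in> {0..1}" for s
    unfolding homothet_def using that assms(2)
    by (auto intro!: convexD[OF assms(1)])
  then have "{s\<in>{0..1}. x \<in> homothet v P s} = {}" using assms(3) by blast
  then show ?thesis unfolding max_weight_def by (simp only: measure_empty)
qed

lemma integral_inner_centroid:
  fixes P :: "'a::euclidean_space set"
  assumes "compact P" "measure lborel P > 0"
  shows "has_bochner_integral lborel (\<lambda>x. indicator P x * (a \<bullet> x)) (measure lborel P * (a \<bullet> centroid P))"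
proof -
  have int: "integrable lborel (\<lambda>x. indicator P x *\<^sub>R x)"
    by (intro borel_integrable_compact assms continuous_intros)
  then have "set_integrable lborel P (\<lambda>x. x)" by (simp add: set_integrable_def)
  then have "(\<integral>x. indicator P x *\<^sub>R x \<partial>lborel) = integral P (\<lambda>x. x)"
    using set_borel_integral_eq_integral(2) by (simp add: set_lebesgue_integral_def)
  also have "\<dots> = measure lborel P *\<^sub>R centroid P"
    using assms by (simp add: centroid_def borel_compact)
  finally have "has_bochner_integral lborel (\<lambda>x. indicator P x *\<^sub>R x) (measure lborel P *\<^sub>R centroid P)"
    using int by (simp add: has_bochner_integral_iff)
  from has_bochner_integral_inner_right[OF this, of a] show ?thesis
    by simp
qed

text \<open>
  With $d = \mathrm{DIM}$, the centroid is a convex combination of the vertices that gives $u$ at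
  least the weight $1/(d + 1)$ and each other vertex at most this weight. The lemma is this bound for one
  linear functional, with a threshold $m$ that is free: vertices above $m$ are counted as if
  they were at $m$. It comes from integrating the pointwise bound, since all maximal weights have
  the same mean $1/(d + 1)$.
\<close>

lemma centroid_lower_bound:
  fixes u :: "'a::euclidean_space" and m :: real
  assumes V: "finite V" "u \<in> V" and m: "m \<le> a \<bullet> u"
    and int: "interior (convex hull V) \<noteq> {}"
  shows "a \<bullet> u + DIM('a) * m - (\<Sum>v\<in>V - {u}. max 0 (m - a \<bullet> v))
     \<le> (DIM('a) + 1) * (a \<bullet> centroid (convex hull V))"
proof -
  let ?P = "convex hull V" and ?d = "real DIM('a)"
  define M where "M = measure lborel ?P"
  have comp: "compact ?P" using V by (simp add: finite_imp_compact_convex_hull)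
  have "\<not> negligible ?P" using int open_not_negligible[of "interior ?P"]
    by (meson interior_subset negligible_subset open_interior)
  then have "measure lebesgue ?P \<noteq> 0"
    using comp by (simp add: negligible_iff_measure0 lmeasurable_compact)
  then have M: "M > 0" using comp by (simp add: M_def borel_compact zero_less_measure_iff)
  have V': "v \<in> ?P" if "v \<in> V" for v using that by (simp add: hull_inc)
  have mw: "has_bochner_integral lborel (max_weight v ?P) (M / (?d + 1))" for v
    using has_integral_max_weight[OF comp] by (simp add: M_def add.commute)
  let ?low = "\<lambda>x. indicator ?P x * m + max_weight u ?P x * (a \<bullet> u - m)
      - (\<Sum>v\<in>V - {u}. max_weight v ?P x * max 0 (m - a \<bullet> v))"
  have low: "has_bochner_integral lborel ?low
     (M * m + M / (?d + 1) * (a \<bullet> u - m) - (\<Sum>v\<in>V - {u}. M / (?d + 1) * max 0 (m - a \<bullet> v)))"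
    using emeasure_compact_finite[OF comp] comp unfolding M_def
    by (intro has_bochner_integral_add has_bochner_integral_diff has_bochner_integral_sum
          has_bochner_integral_mult_left has_bochner_integral_real_indicator mw[unfolded M_def])
       (auto simp: borel_compact)
  have up: "has_bochner_integral lborel (\<lambda>x. indicator ?P x * (a \<bullet> x)) (M * (a \<bullet> centroid ?P))"
    using integral_inner_centroid[OF comp] M by (simp add: M_def)
  have "?low x \<le> indicator ?P x * (a \<bullet> x)" for x
  proof (cases "x \<in> ?P")
    case True
    then show ?thesis using functional_lower_bound[OF V m] by simp
  next
    case False
    then have "max_weight v ?P x = 0" if "v \<in> V" for v
      using max_weight_outside V' that convex_convex_hull by blast
    then show ?thesis using False V by simp
  qed
  with integrable.intros[OF low] integrable.intros[OF up]
  have "integral\<^sup>L lborel ?low \<le> integral\<^sup>L lborel (\<lambda>x. indicator ?P x * (a \<bullet> x))"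
    by (rule integral_mono)
  then have "M * m + M / (?d + 1) * (a \<bullet> u - m) - (\<Sum>v\<in>V - {u}. M / (?d + 1) * max 0 (m - a \<bullet> v))
      \<le> M * (a \<bullet> centroid ?P)"
    unfolding has_bochner_integral_integral_eq[OF low] has_bochner_integral_integral_eq[OF up] .
  then have "M * m + M / (?d + 1) * (a \<bullet> u - m) - M / (?d + 1) * (\<Sum>v\<in>V - {u}. max 0 (m - a \<bullet> v))
      \<le> M * (a \<bullet> centroid ?P)"
    by (simp only: sum_distrib_left)
  then have "(M * m + M / (?d + 1) * (a \<bullet> u - m) - M / (?d + 1) * (\<Sum>v\<in>V - {u}. max 0 (m - a \<bullet> v))) * (?d + 1)
      \<le> M * (a \<bullet> centroid ?P) * (?d + 1)"
    by (rule mult_right_mono) simp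
  moreover have clear: "(M * m + M / q * p - M / q * r) * q = M * (q * m + p - r)" if "q \<noteq> 0" for p q r
    using that by (simp add: field_simps)
  ultimately have "M * ((?d + 1) * m + (a \<bullet> u - m) - (\<Sum>v\<in>V - {u}. max 0 (m - a \<bullet> v)))
      \<le> M * (a \<bullet> centroid ?P) * (?d + 1)"
    by (subst (asm) clear) simp_all
  then have "M * ((?d + 1) * m + (a \<bullet> u - m) - (\<Sum>v\<in>V - {u}. max 0 (m - a \<bullet> v)))
      \<le> M * ((?d + 1) * (a \<bullet> centroid ?P))"
    by (simp only: mult.assoc mult.commute[of "a \<bullet> centroid ?P"])
  then have "(?d + 1) * m + (a \<bullet> u - m) - (\<Sum>v\<in>V - {u}. max 0 (m - a \<bullet> v)) \<le> (?d + 1) * (a \<bullet> centroid ?P)"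
    using M by (simp only: mult_le_cancel_left_pos)
  then show ?thesis by (simp add: algebra_simps)
qed

section \<open>Chains of Thales balls\<close>

lemma thales_first_step:
  fixes u z :: "'a::real_inner"
  assumes "z \<bullet> z \<le> z \<bullet> u"
  shows "1 * (z \<bullet> z) - u \<bullet> z \<le> 0 * (u \<bullet> u)"
  using assms by (simp add: inner_commute)

text \<open>
  The inequality $z \cdot z \le z \cdot v$ puts $z$ into the Thales ball, the ball with diameter
  $[0, v]$. Bounds of the form $A |v|^2 - u \cdot v \le C |u|^2$ are passed on from $v$ to $z$:
  the claim is the expansion of $(A / x) \, |z - x v + \frac{x}{2 A} u|^2 \ge 0$. The parameter $x$ is
  free at each step. In the extremal planar spiral of $k$ steps, whose $i$-th point has polar angle
  $i \theta$ and length $\cos^i \theta$ with $\theta = \pi / (k + 1)$, the squared vector vanishes for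
  $x = \cos \theta \, \sin ((i + 1) \theta) / \sin (i \theta)$, which is where the exact parameters
  below come from. The last step has $x = 1/2$, which removes the quadratic term.
\<close>

lemma thales_step:
  fixes u v z :: "'a::real_inner"
  assumes z: "z \<bullet> z \<le> z \<bullet> v" and v: "A * (v \<bullet> v) - u \<bullet> v \<le> C * (u \<bullet> u)" and "A > 0" "x > 0"
  shows "A * (2 - 1 / x) * (z \<bullet> z) - u \<bullet> z \<le> x * (C + 1 / (4 * A)) * (u \<bullet> u)"
proof -
  define y where "y = z - x *\<^sub>R v + (x / (2 * A)) *\<^sub>R u"
  have yy: "(A / x) * (y \<bullet> y) = (A / x) * (z \<bullet> z) + A * x * (v \<bullet> v) + x / (4 * A) * (u \<bullet> u)
      - 2 * A * (z \<bullet> v) + u \<bullet> z - x * (u \<bullet> v)"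
    using assms(3,4)
    by (simp add: y_def inner_simps inner_commute field_simps)
  have "0 \<le> (A / x) * (y \<bullet> y)" using assms by simp
  moreover have "2 * A * (z \<bullet> z) \<le> 2 * A * (z \<bullet> v)" using z \<open>A > 0\<close> by simp
  moreover have "x * (A * (v \<bullet> v) - u \<bullet> v) \<le> x * (C * (u \<bullet> u))" using v \<open>x > 0\<close> by simp
  ultimately show ?thesis unfolding yy by (simp add: algebra_simps)
qed

text \<open>
  In a chain, the last point cannot be extremal together with the one before it. This is the same square
  as in \<open>thales_step\<close>, with weights chosen for the sum of the two heights.
\<close>

lemma thales_last_pair:
  fixes u v z :: "'a::real_inner"
  assumes z: "z \<bullet> z \<le> z \<bullet> v" and v: "A * (v \<bullet> v) - u \<bullet> v \<le> C * (u \<bullet> u)" and "A > 0"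
  shows "- (u \<bullet> v) - u \<bullet> z \<le> (3 / 2 * C + 1 / (24 * A)) * (u \<bullet> u)"
proof -
  define y where "y = z - (1/2) *\<^sub>R v + (1 / (12 * A)) *\<^sub>R u"
  have yy: "6 * A * (y \<bullet> y) = 6 * A * (z \<bullet> z) + 3 / 2 * A * (v \<bullet> v) + 1 / (24 * A) * (u \<bullet> u)
      - 6 * A * (z \<bullet> v) + u \<bullet> z - 1 / 2 * (u \<bullet> v)"
    using assms(3)
    by (simp add: y_def inner_simps inner_commute field_simps)
  have "0 \<le> 6 * A * (y \<bullet> y)" using assms by simp
  moreover have "6 * A * (z \<bullet> z) \<le> 6 * A * (z \<bullet> v)" using z \<open>A > 0\<close> by simp
  ultimately show ?thesis unfolding yy using v by (simp add: algebra_simps)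
qed

text \<open>
  The extremal spiral of $k$ steps has height $-\cos^{k+1} (\pi / (k + 1))$ at its end. For three and five
  steps this is $-1/4$ and $-27/64$, obtained from the exact parameters; for four steps the parameters are
  rounded to rational numbers. For the last pair of a chain of five, the parameters are rational
  numbers that bring the bound above $-3/4$.
\<close>

lemma thales_chain3:
  fixes u :: "'a::real_inner"
  assumes "x \<bullet> x \<le> x \<bullet> u" "y \<bullet> y \<le> y \<bullet> x" "z \<bullet> z \<le> z \<bullet> y"
  shows "- (1/4) * (u \<bullet> u) \<le> u \<bullet> z"
proof -
  note thales_step[OF assms(2) thales_first_step[OF assms(1)], of 1]
  from thales_step[OF assms(3) this, of "1/2"] show ?thesis by simp
qed

lemma thales_chain4:
  fixes u :: "'a::real_inner"
  assumes "w \<bullet> w \<le> w \<bullet> u" "x \<bullet> x \<le> x \<bullet> w" "y \<bullet> y \<le> y \<bullet> x" "z \<bullet> z \<le> z \<bullet> y"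
  shows "- (26/75) * (u \<bullet> u) \<le> u \<bullet> z"
proof -
  note thales_step[OF assms(2) thales_first_step[OF assms(1)], of "4/3"]
  note thales_step[OF assms(3) this, of "4/5"]
  from thales_step[OF assms(4) this, of "1/2"] show ?thesis by simp
qed

lemma thales_chain5:
  fixes u :: "'a::real_inner"
  assumes "v \<bullet> v \<le> v \<bullet> u" "w \<bullet> w \<le> w \<bullet> v" "x \<bullet> x \<le> x \<bullet> w" "y \<bullet> y \<le> y \<bullet> x" "z \<bullet> z \<le> z \<bullet> y"
  shows "- (27/64) * (u \<bullet> u) \<le> u \<bullet> z" and "- (56/75) * (u \<bullet> u) \<le> u \<bullet> y + u \<bullet> z"
proof -
  note thales_step[OF assms(2) thales_first_step[OF assms(1)], of "3/2"]
  note thales_step[OF assms(3) this, of 1]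
  note thales_step[OF assms(4) this, of "3/4"]
  from thales_step[OF assms(5) this, of "1/2"] show "- (27/64) * (u \<bullet> u) \<le> u \<bullet> z" by simp
  note thales_step[OF assms(2) thales_first_step[OF assms(1)], of "7/5"]
  note thales_step[OF assms(3) this, of "6/7"]
  note thales_step[OF assms(4) this, of "3/5"]
  from thales_last_pair[OF assms(5) this] show "- (56/75) * (u \<bullet> u) \<le> u \<bullet> y + u \<bullet> z" by simp
qed

lemma thales_norm_less:
  fixes v w :: "'a::real_inner"
  assumes "v \<bullet> v \<le> v \<bullet> w" "w \<noteq> v"
  shows "norm v < norm w"
proof -
  have "0 < (w - v) \<bullet> (w - v)" using assms by simp
  also have "\<dots> \<le> w \<bullet> w - v \<bullet> v" using assms by (simp add: inner_simps inner_commute)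
  finally show ?thesis by (simp add: norm_lt)
qed

text \<open>
  The choice of a $w$ for every $v$ gives a parent map, along which norms increase; so it is a
  tree with root $u$. Only points that are at least four steps away from $u$ can have a height below
  $-|u|^2/4$, and there are at most two of them among five points. If none is farther than four
  steps away, each contributes at most $(26/75 - 1/4) |u|^2$; otherwise all points form one chain, and the bound on
  the sum of its last two heights applies.
\<close>

lemma five_thales_points:
  fixes u :: "'a::real_inner"
  assumes N: "finite N" "card N \<le> 5" "N \<noteq> {}"
    and thales: "\<And>v. v \<in> N \<Longrightarrow> \<exists>w\<in>insert u N. w \<noteq> v \<and> v \<bullet> v \<le> v \<bullet> w"
  shows "(\<Sum>v\<in>N. max 0 (- (1/4) * (u \<bullet> u) - u \<bullet> v)) < (u \<bullet> u) / 4"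
proof -
  have "Max (norm ` N) \<in> norm ` N" using N by simp
  then obtain v where "v \<in> N" "norm v = Max (norm ` N)" by (metis imageE)
  then have v: "v \<in> N" "\<And>w. w \<in> N \<Longrightarrow> norm w \<le> norm v"
    using N(1) by simp_all
  then have "norm v < norm u"
    using thales[OF v(1)] thales_norm_less by (metis insert_iff not_le)
  then have uu: "u \<bullet> u > 0" by (smt (verit) norm_ge_zero inner_gt_zero_iff norm_zero)
  have uN: "u \<notin> N" using v \<open>norm v < norm u\<close> by force
  obtain p where p: "\<And>v. v \<in> N \<Longrightarrow> p v \<in> insert u N \<and> p v \<noteq> v \<and> v \<bullet> v \<le> v \<bullet> p v" and pu: "p u = u"
  proof -
    obtain q where "\<And>v. v \<in> N \<Longrightarrow> q v \<in> insert u N \<and> q v \<noteq> v \<and> v \<bullet> v \<le> v \<bullet> q v"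
      using thales by metis
    \<comment> \<open>making the root its own parent allows chains shorter than the lemmas ask for: they are prolonged by repeating $u$\<close>
    with uN show ?thesis by (intro that[of "q(u := u)"]) auto
  qed
  have pV: "p v \<in> insert u N" and pT: "v \<bullet> v \<le> v \<bullet> p v" if "v \<in> insert u N" for v
    using p that pu by (auto 4 3)
  have less: "norm v < norm (p v)" if "v \<in> N" for v
    using p[OF that] thales_norm_less by blast
  let ?e = "\<lambda>v. max 0 (- (1/4) * (u \<bullet> u) - u \<bullet> v)"
  have e3: "?e v = 0" if "v \<in> N" "p (p (p v)) = u" for v
    using thales_chain3[of "p (p v)" u "p v" v] pT[of v] pT[of "p v"] pT[of "p (p v)"] pV that by (simp add: max_def)
  have pN: "p v \<in> N" if "v \<in> N" "p v \<noteq> u" for v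
    using p[OF that(1)] that(2) by blast
  show ?thesis
  proof (cases "\<exists>x\<in>N. p (p (p (p x))) \<noteq> u")
    case True
    then obtain x where x: "x \<in> N" "p (p (p (p x))) \<noteq> u" by blast
    define x1 where "x1 = p x"
    define x2 where "x2 = p x1"
    define x3 where "x3 = p x2"
    define x4 where "x4 = p x3"
    note defs = x1_def x2_def x3_def x4_def
    have "x4 \<noteq> u" using x(2) unfolding defs .
    then have "x3 \<noteq> u" using pu x4_def by metis
    then have "x2 \<noteq> u" using pu x3_def by metis
    then have "x1 \<noteq> u" using pu x2_def by metis
    have x1: "x1 \<in> N" using pN[OF x(1)] \<open>x1 \<noteq> u\<close> unfolding x1_def by simp
    have x2: "x2 \<in> N" using pN[OF x1] \<open>x2 \<noteq> u\<close> unfolding x2_def by simp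
    have x3: "x3 \<in> N" using pN[OF x2] \<open>x3 \<noteq> u\<close> unfolding x3_def by simp
    have x4: "x4 \<in> N" using pN[OF x3] \<open>x4 \<noteq> u\<close> unfolding x4_def by simp
    have ord: "norm x < norm x1" "norm x1 < norm x2" "norm x2 < norm x3" "norm x3 < norm x4"
      using less[OF x(1)] less[OF x1] less[OF x2] less[OF x3] by (simp_all only: defs)
    let ?c = "[x, x1, x2, x3, x4]"
    have dist: "distinct ?c" using ord by auto
    have cN: "set ?c \<subseteq> N" using x(1) x1 x2 x3 x4 by simp
    have "card (set ?c) = 5" using distinct_card[OF dist] by simp
    then have Nc: "N = set ?c" using card_seteq[OF N(1) cN] N(2) by simp
    have p5: "p x4 = u"
    proof (rule ccontr)
      assume "p x4 \<noteq> u"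
      then have "p x4 \<in> set ?c" using pN[OF x4] Nc by blast
      then have "norm (p x4) \<le> norm x4" using ord by auto
      then show False using less[OF x4] by simp
    qed
    have "?e x2 = 0" "?e x3 = 0" "?e x4 = 0"
      using e3[OF x2] e3[OF x3] e3[OF x4] p5 pu x3_def x4_def by simp_all
    moreover have "sum ?e N = ?e x + ?e x1 + ?e x2 + ?e x3 + ?e x4"
      unfolding Nc using dist by (simp add: add.assoc)
    ultimately have S: "sum ?e N = ?e x + ?e x1" by simp
    have T: "x \<bullet> x \<le> x \<bullet> x1" "x1 \<bullet> x1 \<le> x1 \<bullet> x2" "x2 \<bullet> x2 \<le> x2 \<bullet> x3"
        "x3 \<bullet> x3 \<le> x3 \<bullet> x4" "x4 \<bullet> x4 \<le> x4 \<bullet> u"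
      using p[OF x(1)] p[OF x1] p[OF x2] p[OF x3] p[OF x4] p5 by (simp_all add: defs)
    have "?e x + ?e x1 < (u \<bullet> u) / 4"
      using thales_chain4[OF T(5,4,3,2)] thales_chain5[OF T(5,4,3,2,1)] uu by linarith
    then show ?thesis using S by simp
  next
    case False
    then have p4: "p (p (p (p v))) = u" if "v \<in> N" for v using that by blast
    let ?D = "{v \<in> N. p (p (p v)) \<noteq> u}"
    have card: "card ?D \<le> 2"
    proof (cases "?D = {}")
      case True
      then show ?thesis by (simp only: card.empty)
    next
      case False
      then obtain x where x: "x \<in> N" "p (p (p x)) \<noteq> u" by blast
      define x1 where "x1 = p x"
      define x2 where "x2 = p x1"
      define x3 where "x3 = p x2"
      note defs = x1_def x2_def x3_def
      have "x3 \<noteq> u" using x(2) unfolding defs .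
      then have "x2 \<noteq> u" using pu x3_def by metis
      then have "x1 \<noteq> u" using pu x2_def by metis
      have x1: "x1 \<in> N" using pN[OF x(1)] \<open>x1 \<noteq> u\<close> unfolding x1_def by simp
      have x2: "x2 \<in> N" using pN[OF x1] \<open>x2 \<noteq> u\<close> unfolding x2_def by simp
      have x3: "x3 \<in> N" using pN[OF x2] \<open>x3 \<noteq> u\<close> unfolding x3_def by simp
      let ?c = "[x1, x2, x3]"
      have "distinct ?c" using less[OF x1] less[OF x2] by (auto simp: x2_def x3_def)
      then have "card (set ?c) = 3" using distinct_card by fastforce
      moreover have cN: "set ?c \<subseteq> N" using x1 x2 x3 by simp
      moreover have "p x3 = u" using p4[OF x(1)] unfolding defs .
      then have "?D \<subseteq> N - set ?c" using pu x2_def x3_def by auto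
      then have "card ?D \<le> card (N - set ?c)" using N(1) by (intro card_mono) auto
      ultimately show ?thesis using N card_Diff_subset[of "set ?c" N] by simp
    qed
    have "sum ?e N = sum ?e ?D" using e3 N by (intro sum.mono_neutral_right) auto
    also have "\<dots> \<le> real (card ?D) * (29/300 * (u \<bullet> u))"
    proof (rule sum_bounded_above)
      fix v assume "v \<in> ?D"
      then have v: "v \<in> insert u N" "p (p (p (p v))) = u" using p4 by auto
      have "- (26/75) * (u \<bullet> u) \<le> u \<bullet> v"
        using thales_chain4[of "p (p (p v))" u "p (p v)" "p v" v]
          pT[of v] pT[of "p v"] pT[of "p (p v)"] pT[of "p (p (p v))"] pV v by simp
      then show "?e v \<le> 29/300 * (u \<bullet> u)" using uu by linarith
    qed
    also have "\<dots> \<le> 2 * (29/300 * (u \<bullet> u))"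
      using card uu by (intro mult_right_mono) auto
    also have "\<dots> < (u \<bullet> u) / 4" using uu by linarith
    finally show ?thesis .
  qed
qed

section \<open>Vertices of mono-unstable polytopes\<close>

lemma vertices_polytope:
  fixes P :: "'a::euclidean_space set"
  assumes "polytope P"
  shows "finite (vertices P)" "convex hull (vertices P) = P"
  using assms Krein_Milman_Minkowski[of P] finite_polyhedron_extreme_points[of P]
  by (auto simp: vertices_def polytope_imp_polyhedron polytope_imp_compact polytope_imp_convex)

text \<open>
  If all other vertices were strictly on the near side of the orthoplane, a point of the polytope on
  the orthoplane would give them no weight, and so be $v$ itself.
\<close>

lemma not_unstable_imp_thales:
  fixes P :: "'a::euclidean_space set"
  assumes P: "polytope P" and v: "v \<in> vertices P" "\<not> unstable_vertex P v"
  shows "\<exists>w\<in>vertices P. w \<noteq> v \<and> (v - centroid P) \<bullet> (w - v) \<ge> 0"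
proof (rule ccontr)
  let ?V = "vertices P" and ?a = "v - centroid P"
  assume "\<not> ?thesis"
  then have neg: "?a \<bullet> (w - v) < 0" if "w \<in> ?V" "w \<noteq> v" for w using that by force
  note V = vertices_polytope[OF P]
  have "x = v" if x: "x \<in> vertex_orthoplane P v" "x \<in> P" for x
  proof -
    have "x \<in> convex hull ?V" using x(2) V(2) by simp
    then obtain l where l: "\<And>w. w \<in> ?V \<Longrightarrow> 0 \<le> l w" "sum l ?V = 1" "x = (\<Sum>w\<in>?V. l w *\<^sub>R w)"
      unfolding convex_hull_finite[OF V(1)] by blast
    have "(\<Sum>w\<in>?V. l w * - (?a \<bullet> (w - v))) = - (?a \<bullet> (x - v))"
      using l(2) by (simp add: l(3) inner_diff_right inner_sum_right right_diff_distrib sum_subtractf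
          flip: sum_distrib_right)
    also have "\<dots> = 0" using x by (simp add: vertex_orthoplane_def)
    finally have "\<forall>w\<in>?V. l w * - (?a \<bullet> (w - v)) = 0"
      using l neg V(1) by (subst (asm) sum_nonneg_eq_0_iff)
        (auto intro!: mult_nonneg_nonpos simp: mult_le_0_iff, metis diff_self inner_zero_right less_eq_real_def)
    then have l0: "l w = 0" if "w \<in> ?V" "w \<noteq> v" for w using neg that by force
    have "(\<Sum>w\<in>?V. l w *\<^sub>R w) = (\<Sum>w\<in>?V. l w *\<^sub>R v)" using l0 by (intro sum.cong) auto
    then show ?thesis using l by (simp flip: scaleR_left.sum)
  qed
  moreover have "v \<in> P" using v by (simp add: vertices_def extreme_point_of_def)
  ultimately have "vertex_orthoplane P v \<inter> P = {v}" by (auto simp: vertex_orthoplane_def)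
  then show False using v by (simp add: unstable_vertex_def)
qed

theorem theorem1:
  fixes P :: "(real ^ 3) set"
  assumes "polytope P"
    and "interior P \<noteq> {}"
    and "mono_unstable P"
  shows "card (vertices P) \<ge> 7"
proof (rule ccontr)
  assume "\<not> 7 \<le> card (vertices P)"
  then have six: "card (vertices P) \<le> 6" by simp
  obtain u where u: "unstable_vertex P u" and unique: "\<And>v. unstable_vertex P v \<Longrightarrow> v = u"
    using assms(3) unfolding mono_unstable_def by auto
  define c where "c = centroid P"
  define a where "a = u - c"
  let ?V = "vertices P" and ?rel = "\<lambda>v. v - c"
  let ?N = "?rel ` (?V - {u})"
  note V = vertices_polytope[OF assms(1)]
  have uV: "u \<in> ?V" using u by (simp add: unstable_vertex_def)
  have "card ?N \<le> card (?V - {u})" using V(1) by (intro card_image_le) auto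
  then have cardN: "card ?N \<le> 5" using six uV V(1) by simp
  have "?V \<noteq> {u}" using V(2) assms(2) by auto
  then have "?N \<noteq> {}" using uV by auto
  have thales: "\<exists>w\<in>insert a ?N. w \<noteq> v \<and> v \<bullet> v \<le> v \<bullet> w" if v: "v \<in> ?N" for v
  proof -
    obtain v' where v': "v' \<in> ?V" "v' \<noteq> u" "v = v' - c" using v by auto
    then obtain w where w: "w \<in> ?V" "w \<noteq> v'" "(v' - c) \<bullet> (w - v') \<ge> 0"
      using not_unstable_imp_thales[OF assms(1)] unique unfolding c_def by metis
    then have "w - c \<in> insert a ?N" "w - c \<noteq> v" using v' by (auto simp: a_def)
    moreover have "w - v' = (w - c) - v" using v' by simp
    then have "v \<bullet> v \<le> v \<bullet> (w - c)" using w(3) v' by (simp add: inner_diff_right)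
    ultimately show ?thesis by blast
  qed
  have "(\<Sum>v\<in>?N. max 0 (- (1/4) * (a \<bullet> a) - a \<bullet> v)) < (a \<bullet> a) / 4"
    using five_thales_points[OF _ cardN \<open>?N \<noteq> {}\<close> thales] V(1) by simp
  moreover have "(\<Sum>v\<in>?N. max 0 (- (1/4) * (a \<bullet> a) - a \<bullet> v))
      = (\<Sum>v\<in>?V - {u}. max 0 (a \<bullet> c - (a \<bullet> a) / 4 - a \<bullet> v))"
    by (subst sum.reindex) (auto simp: inj_on_def inner_diff_right intro!: sum.cong arg_cong[of _ _ "max 0"])
  moreover have au: "a \<bullet> u = a \<bullet> c + a \<bullet> a" by (simp add: a_def inner_diff_right)
  have below: "a \<bullet> c - (a \<bullet> a) / 4 \<le> a \<bullet> u"
    unfolding au using inner_ge_zero[of a] by linarith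
  have "a \<bullet> u + 3 * (a \<bullet> c - (a \<bullet> a) / 4) - (\<Sum>v\<in>?V - {u}. max 0 (a \<bullet> c - (a \<bullet> a) / 4 - a \<bullet> v))
      \<le> 4 * (a \<bullet> c)"
    using centroid_lower_bound[OF V(1) uV below] assms(2)
    by (simp add: V(2) c_def[symmetric])
  ultimately show False using au by simp
qed

end
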